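(* Let $a\in[0,\infty)$, $b\in\mathbb{R}$, $\sigma\in(0,\infty)$, $y_0\in[0,\infty)$, and let $m$ be a L\'evy measure on $(0,\infty)$ with $\int_0^\infty z\,m(\mathrm{d}z)<\infty$. Let $(Y_t)_{t\geq0}$ be the unique strong solution of $$\mathrm{d}Y_t = (a - bY_t)\,\mathrm{d}t + \sigma\sqrt{Y_t}\,\mathrm{d}W_t + \mathrm{d}J_t,\qquad t\in[0,\infty),\qquad Y_0=y_0.$$ If $a>0$ or $y_0>0$, then for each $T\in(0,\infty)$ there exists a unique maximum likelihood estimator (MLE) $\widehat b_T$ of $b$ almost surely, having the form $$\widehat b_T = -\frac{Y_T - y_0 - aT - J_T}{\int_0^T Y_s\,\mathrm{d}s},$$ provided that $\int_0^T Y_s\,\mathrm{d}s\in(0,\infty)$ (which holds almost surely).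
   Context: $(W_t)_{t\geq0}$ is a one-dimensional standard Wiener process and $(J_t)_{t\geq0}$ is a subordinator, independent of $W$, with zero drift and L\'evy measure $m$, i.e. $\mathbb{E}(\mathrm{e}^{uJ_t}) = \exp\{t\int_0^\infty(\mathrm{e}^{uz}-1)\,m(\mathrm{d}z)\}$ for all $t\geq0$ and all complex $u$ with $\mathrm{Re}(u)\leq0$. The SDE has a pathwise unique strong solution, and it is almost surely non-negative for all times. The parameters $a,\sigma$, the measure $m$ and $y_0$ are known, and $b$ is the unknown parameter, estimated from the observations $(Y_t)_{t\in[0,T]}$. For a fixed reference parameter $\widetilde b\in\mathbb{R}$, the log-likelihood function is $$\Lambda_T(\beta,\widetilde b) := -\frac{\beta-\widetilde b}{\sigma^2}(Y_T-y_0-aT-J_T) - \frac{\beta^2-\widetilde b^2}{2\sigma^2}\int_0^T Y_s\,\mathrm{d}s,\qquad \beta\in\mathbb{R}$$ (the logarithm of the Radon--Nikodym derivative of the law of the solution on $[0,T]$ with parameter $\beta$ with respect to that with parameter $\widetilde b$, evaluated at the observed path). An MLE based on $(Y_t)_{t\in[0,T]}$ is $\widehat b_T := \arg\max_{\beta\in\mathbb{R}}\Lambda_T(\beta,\widetilde b)$. (It does not depend on $\widetilde b$. Moreover $J_t=\sum_{s\in[0,t]}\Delta Y_s$, $t\geq 0$, where $\Delta Y_s$ denotes the jump of $Y$ at time $s$, so these expressions are functions of the observed path.) *)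

theory Defs
  imports "HOL-Probability.Probability"
begin

text \<open>
  A process is a function of time and outcome. The time domain is the half-line of non-negative
  reals; values at negative times are irrelevant. Path properties are only required almost surely.
\<close>

type_synonym 'a process = "real \<Rightarrow> 'a \<Rightarrow> real"

definition cadlag :: "(real \<Rightarrow> real) \<Rightarrow> bool" where
  "cadlag f \<longleftrightarrow>
     (\<forall>t\<ge>0. (f \<longlongrightarrow> f t) (at_right t)) \<and> (\<forall>t>0. \<exists>l. (f \<longlongrightarrow> l) (at_left t))"

definition independent_increments :: "'a measure \<Rightarrow> 'a process \<Rightarrow> bool" where
  "independent_increments M X \<longleftrightarrow>
     (\<forall>n. \<forall>\<tau> :: nat \<Rightarrow> real. 0 \<le> \<tau> 0 \<longrightarrow> strict_mono_on {..n} \<tau> \<longrightarrow>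
        prob_space.indep_vars M (\<lambda>_. borel) (\<lambda>i \<omega>. X (\<tau> (Suc i)) \<omega> - X (\<tau> i) \<omega>) {..<n})"

definition wiener_process :: "'a measure \<Rightarrow> 'a process \<Rightarrow> bool" where
  "wiener_process M W \<longleftrightarrow>
     (\<forall>t\<ge>0. W t \<in> borel_measurable M) \<and>
     (AE \<omega> in M. W 0 \<omega> = 0) \<and>
     (AE \<omega> in M. continuous_on {0..} (\<lambda>t. W t \<omega>)) \<and>
     independent_increments M W \<and>
     (\<forall>s t. 0 \<le> s \<longrightarrow> s < t \<longrightarrow>
        distributed M lborel (\<lambda>\<omega>. W t \<omega> - W s \<omega>) (normal_density 0 (sqrt (t - s))))"

definition levy_measure_pos :: "real measure \<Rightarrow> bool" where
  "levy_measure_pos m \<longleftrightarrow>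
     sets m = sets borel \<and> emeasure m {..0} = 0 \<and>
     (\<integral>\<^sup>+z. ennreal (min 1 (z\<^sup>2)) \<partial>m) < \<infinity>"

text \<open>The absence of a linear term in the Laplace exponent expresses that the drift is zero.\<close>

definition driftless_subordinator :: "'a measure \<Rightarrow> real measure \<Rightarrow> 'a process \<Rightarrow> bool" where
  "driftless_subordinator M m J \<longleftrightarrow>
     (\<forall>t\<ge>0. J t \<in> borel_measurable M) \<and>
     (AE \<omega> in M. J 0 \<omega> = 0) \<and>
     (AE \<omega> in M. cadlag (\<lambda>t. J t \<omega>) \<and> mono_on {0..} (\<lambda>t. J t \<omega>)) \<and>
     independent_increments M J \<and>
     (\<forall>s t. 0 \<le> s \<longrightarrow> s \<le> t \<longrightarrow>
        distr M borel (\<lambda>\<omega>. J t \<omega> - J s \<omega>) = distr M borel (J (t - s))) \<and>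
     (\<forall>t\<ge>0. \<forall>u :: complex. Re u \<le> 0 \<longrightarrow>
        (LINT \<omega>|M. exp (u * of_real (J t \<omega>))) =
          exp (of_real t * (LINT z:{0<..}|m. exp (u * of_real z) - 1)))"

definition independent_processes :: "'a measure \<Rightarrow> 'a process \<Rightarrow> 'a process \<Rightarrow> bool" where
  "independent_processes M X Z \<longleftrightarrow>
     prob_space.indep_var M
       (PiM {0..} (\<lambda>_. borel)) (\<lambda>\<omega>. \<lambda>t\<in>{0..}. X t \<omega>)
       (PiM {0..} (\<lambda>_. borel)) (\<lambda>\<omega>. \<lambda>t\<in>{0..}. Z t \<omega>)"

text \<open>The filtration generated by \<open>W\<close> and \<open>J\<close>, augmented by the null sets of \<open>M\<close>.\<close>

definition augmented_filtration ::
    "'a measure \<Rightarrow> 'a process \<Rightarrow> 'a process \<Rightarrow> real \<Rightarrow> 'a measure" where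
  "augmented_filtration M W J t =
     sigma (space M)
       ({W s -` B \<inter> space M | s B. s \<in> {0..t} \<and> B \<in> sets borel} \<union>
        {J s -` B \<inter> space M | s B. s \<in> {0..t} \<and> B \<in> sets borel} \<union> null_sets M)"

definition adapted :: "(real \<Rightarrow> 'a measure) \<Rightarrow> 'a process \<Rightarrow> bool" where
  "adapted F X \<longleftrightarrow> (\<forall>t\<ge>0. X t \<in> borel_measurable (F t))"

text \<open>
  Convergence to zero in probability. The covering events \<open>A n\<close> make this outer convergence, so
  that the notion stays meaningful for functions that are measurable only up to a null set
  (the library's \<^const>\<open>measure\<close> is \<open>0\<close> on non-measurable sets). For measurable \<open>Z n\<close> it is the
  usual convergence in probability.
\<close>

definition vanishes_in_prob :: "'a measure \<Rightarrow> (nat \<Rightarrow> 'a \<Rightarrow> ennreal) \<Rightarrow> bool" where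
  "vanishes_in_prob M Z \<longleftrightarrow>
     (\<forall>\<epsilon>>0. \<exists>A. (\<forall>n. A n \<in> sets M \<and> {\<omega> \<in> space M. ennreal \<epsilon> < Z n \<omega>} \<subseteq> A n) \<and>
        (\<lambda>n. measure M (A n)) \<longlonglongrightarrow> 0)"

text \<open>
  The triple \<open>(k, \<tau>, \<xi>)\<close> encodes the simple process that equals \<open>\<xi> i\<close> on the time interval
  \<open>{\<tau> i<..\<tau> (Suc i)}\<close> for \<open>i < k\<close> and is zero at all other times.
\<close>

type_synonym 'a simple_process = "nat \<times> (nat \<Rightarrow> real) \<times> (nat \<Rightarrow> 'a \<Rightarrow> real)"

fun is_simple_process :: "'a measure \<Rightarrow> (real \<Rightarrow> 'a measure) \<Rightarrow> 'a simple_process \<Rightarrow> bool" where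
  "is_simple_process M F (k, \<tau>, \<xi>) \<longleftrightarrow>
     0 \<le> \<tau> 0 \<and> strict_mono_on {..k} \<tau> \<and>
     (\<forall>i<k. \<xi> i \<in> borel_measurable (F (\<tau> i)) \<and> (\<exists>C. \<forall>\<omega>\<in>space M. \<bar>\<xi> i \<omega>\<bar> \<le> C))"

fun simple_value :: "'a simple_process \<Rightarrow> 'a process" where
  "simple_value (k, \<tau>, \<xi>) s \<omega> = (\<Sum>i<k. \<xi> i \<omega> * indicator {\<tau> i<..\<tau> (Suc i)} s)"

fun simple_integral :: "'a process \<Rightarrow> 'a simple_process \<Rightarrow> 'a process" where
  "simple_integral W (k, \<tau>, \<xi>) t \<omega> =
     (\<Sum>i<k. \<xi> i \<omega> * (W (min t (\<tau> (Suc i))) \<omega> - W (min t (\<tau> i)) \<omega>))"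

text \<open>
  \<open>I\<close> is (a version of) the process \<open>\<integral>\<^sub>0\<^sup>t H\<^sub>s dW\<^sub>s\<close>, for adapted integrands that are almost surely
  locally square integrable in time. As usual, it is the continuous limit in probability of the
  integrals of simple processes approximating \<open>H\<close> in \<open>L\<^sup>2([0,t])\<close> in probability, and it is unique
  up to indistinguishability when \<open>W\<close> is a Wiener process with respect to \<open>F\<close>.
\<close>

definition is_ito_integral ::
    "'a measure \<Rightarrow> (real \<Rightarrow> 'a measure) \<Rightarrow> 'a process \<Rightarrow> 'a process \<Rightarrow> 'a process \<Rightarrow> bool" where
  "is_ito_integral M F W H I \<longleftrightarrow>
     adapted F H \<and>
     (AE \<omega> in M. \<forall>t\<ge>0. set_borel_measurable lborel {0..t} (\<lambda>s. H s \<omega>) \<and>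
        (\<integral>\<^sup>+s\<in>{0..t}. ennreal ((H s \<omega>)\<^sup>2) \<partial>lborel) < \<infinity>) \<and>
     adapted F I \<and>
     (AE \<omega> in M. continuous_on {0..} (\<lambda>t. I t \<omega>)) \<and>
     (\<exists>S. (\<forall>n. is_simple_process M F (S n)) \<and>
        (\<forall>t\<ge>0. vanishes_in_prob M
           (\<lambda>n \<omega>. \<integral>\<^sup>+s\<in>{0..t}. ennreal ((simple_value (S n) s \<omega> - H s \<omega>)\<^sup>2) \<partial>lborel)) \<and>
        (\<forall>t\<ge>0. vanishes_in_prob M
           (\<lambda>n \<omega>. ennreal \<bar>simple_integral W (S n) t \<omega> - I t \<omega>\<bar>)))"

text \<open>
  Strong solutions of \<open>dY\<^sub>t = (a - b Y\<^sub>t) dt + \<sigma> \<surd>Y\<^sub>t dW\<^sub>t + dJ\<^sub>t\<close> with \<open>Y\<^sub>0 = y\<^sub>0\<close>. Non-negativity is part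
  of the notion, since the square root in the equation is only meaningful for such paths
  (\<^const>\<open>sqrt\<close> is an odd function on all reals).
\<close>

definition strong_solution ::
    "'a measure \<Rightarrow> 'a process \<Rightarrow> 'a process \<Rightarrow> real \<Rightarrow> real \<Rightarrow> real \<Rightarrow> real \<Rightarrow> 'a process \<Rightarrow> bool" where
  "strong_solution M W J a b \<sigma> y\<^sub>0 Y \<longleftrightarrow>
     adapted (augmented_filtration M W J) Y \<and>
     (AE \<omega> in M. cadlag (\<lambda>t. Y t \<omega>)) \<and>
     (AE \<omega> in M. \<forall>t\<ge>0. 0 \<le> Y t \<omega>) \<and>
     (AE \<omega> in M. Y 0 \<omega> = y\<^sub>0) \<and>
     (\<exists>I. is_ito_integral M (augmented_filtration M W J) W (\<lambda>s \<omega>. \<sigma> * sqrt (Y s \<omega>)) I \<and>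
        (AE \<omega> in M. \<forall>t\<ge>0.
           Y t \<omega> = y\<^sub>0 + (LBINT s:{0..t}. a - b * Y s \<omega>) + I t \<omega> + J t \<omega>))"

text \<open>
  The log-likelihood at \<open>\<beta>\<close> with reference parameter \<open>\<beta>\<^sub>0\<close>, for an observed path \<open>y\<close> whose jump part
  up to time \<open>T\<close> is \<open>j\<close>.
\<close>

definition log_likelihood ::
    "real \<Rightarrow> real \<Rightarrow> real \<Rightarrow> real \<Rightarrow> (real \<Rightarrow> real) \<Rightarrow> real \<Rightarrow> real \<Rightarrow> real \<Rightarrow> real" where
  "log_likelihood a \<sigma> y\<^sub>0 T y j \<beta>\<^sub>0 \<beta> =
     - ((\<beta> - \<beta>\<^sub>0) / \<sigma>\<^sup>2) * (y T - y\<^sub>0 - a * T - j)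
     - (\<beta>\<^sup>2 - \<beta>\<^sub>0\<^sup>2) / (2 * \<sigma>\<^sup>2) * (LBINT s:{0..T}. y s)"

definition is_mle ::
    "real \<Rightarrow> real \<Rightarrow> real \<Rightarrow> real \<Rightarrow> (real \<Rightarrow> real) \<Rightarrow> real \<Rightarrow> real \<Rightarrow> real \<Rightarrow> bool" where
  "is_mle a \<sigma> y\<^sub>0 T y j \<beta>\<^sub>0 \<beta> \<longleftrightarrow>
     is_arg_max (log_likelihood a \<sigma> y\<^sub>0 T y j \<beta>\<^sub>0) (\<lambda>_. True) \<beta>"

end

theory Submission
  imports Defs
begin

text \<open>
  As a function of \<open>\<beta>\<close>, the log-likelihood is a quadratic polynomial with leading coefficient
  \<open>-Q / (2 \<sigma>\<^sup>2)\<close>, where \<open>Q = \<integral>\<^sub>0\<^sup>T Y\<^sub>s ds\<close>. Once \<open>0 < Q < \<infinity>\<close> it has exactly one maximizer, found by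
  completing the square. The substance is therefore that \<open>Q\<close> is almost surely finite and positive.

  Finiteness is built into the equation: the integrand \<open>\<sigma> \<surd>Y\<close> of the stochastic integral is locally
  square integrable, and its square is \<open>\<sigma>\<^sup>2 Y\<close>.

  For positivity, a right-continuous non-negative path with \<open>Q = 0\<close> vanishes on \<open>[0,T)\<close>. This excludes
  \<open>y\<^sub>0 > 0\<close>. If \<open>y\<^sub>0 = 0\<close> and \<open>a > 0\<close>, the equation at a time \<open>t\<close> in \<open>(0,T)\<close> reads \<open>0 = a t + I\<^sub>t + J\<^sub>t\<close>,
  where \<open>I\<close> is the stochastic integral and \<open>J\<^sub>t \<ge> 0\<close>. This is a contradiction as soon as \<open>I\<^sub>t = 0\<close> almost
  surely on the event that the integrand vanishes on \<open>[0,t]\<close>, that is, as soon as the stochastic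
  integral is local (\<open>ito_integral_eq_0_where_integrand_eq_0\<close>).

  Locality follows from an inequality of Lenglart type for a simple process \<open>S\<close>
  (\<open>simple_integral_tail_bound\<close>): the event that \<open>|\<integral>\<^sub>0\<^sup>t S dW| \<ge> e\<close> and \<open>\<integral>\<^sub>0\<^sup>t S\<^sup>2 ds \<le> \<delta>\<close> has probability at
  most \<open>\<delta> / e\<^sup>2\<close>. Indeed, if \<open>S\<close> is switched off before its energy exceeds \<open>\<delta>\<close>, nothing changes on this
  event, and the bound becomes Markov's inequality combined with the isometry
  (\<open>simple_ito_isometry\<close>). Where the integrand vanishes, the energies of the approximating simple
  processes tend to zero in probability, hence so do their integrals.

  The isometry rests on the independence of the increments of \<open>W\<close> after time \<open>s\<close> from the whole
  \<open>\<sigma>\<close>-algebra generated by \<open>W\<close> and \<open>J\<close> up to time \<open>s\<close> and the null sets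
  (\<open>increment_indep_of_past\<close>), which a \<open>\<pi>\<close>-\<open>\<lambda>\<close> argument derives from the independence of \<open>W\<close> and \<open>J\<close> and
  the independence of the increments of \<open>W\<close>.
\<close>

section \<open>The quadratic likelihood\<close>

lemma log_likelihood_unique_maximizer:
  assumes "0 < \<sigma>" and Q: "0 < (LBINT s:{0..T}. y s)"
  shows "(\<exists>!\<beta>. is_mle a \<sigma> y\<^sub>0 T y j \<beta>\<^sub>0 \<beta>) \<and>
    is_mle a \<sigma> y\<^sub>0 T y j \<beta>\<^sub>0 (- ((y T - y\<^sub>0 - a * T - j) / (LBINT s:{0..T}. y s)))"
proof -
  define Q where "Q = (LBINT s:{0..T}. y s)"
  define N where "N = y T - y\<^sub>0 - a * T - j"
  define L where "L = log_likelihood a \<sigma> y\<^sub>0 T y j \<beta>\<^sub>0"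
  have Qpos: "0 < Q" using Q by (simp add: Q_def)
  \<comment> \<open>Completing the square; \<open>- (N / Q)\<close> is the vertex of the parabola.\<close>
  have gap: "L \<beta> = L (- (N / Q)) - Q / (2 * \<sigma>\<^sup>2) * (\<beta> + N / Q)\<^sup>2" for \<beta>
    using Qpos \<open>0 < \<sigma>\<close> unfolding L_def log_likelihood_def N_def[symmetric] Q_def[symmetric]
    by (simp add: field_simps power2_eq_square)
  have c: "0 < Q / (2 * \<sigma>\<^sup>2)" using Qpos \<open>0 < \<sigma>\<close> by simp
  have less: "L \<beta> < L (- (N / Q))" if "\<beta> \<noteq> - (N / Q)" for \<beta>
  proof -
    have "0 < (\<beta> + N / Q)\<^sup>2" using that by (simp add: add_eq_0_iff2)
    with c have "0 < Q / (2 * \<sigma>\<^sup>2) * (\<beta> + N / Q)\<^sup>2" by (rule mult_pos_pos)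
    then show ?thesis using gap[of \<beta>] by linarith
  qed
  have "is_arg_max L (\<lambda>_. True) \<beta> \<longleftrightarrow> \<beta> = - (N / Q)" for \<beta>
    unfolding is_arg_max_def using less by (metis order.asym)
  then show ?thesis
    unfolding is_mle_def L_def[symmetric] N_def[symmetric] Q_def[symmetric] by simp
qed

section \<open>The filtration of the driving noise\<close>

text \<open>
  The properties of the noise that make the stochastic integral with respect to \<open>W\<close> well behaved in
  the filtration that is enlarged by \<open>J\<close>.
\<close>

locale driving_noise = prob_space M for M :: "'a measure" +
  fixes W J :: "'a process"
  assumes wiener: "wiener_process M W"
    and measurable_J: "0 \<le> t \<Longrightarrow> J t \<in> borel_measurable M"
    and indep_W_J: "independent_processes M W J"
begin

abbreviation F :: "real \<Rightarrow> 'a measure" where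
  "F \<equiv> augmented_filtration M W J"

lemma measurable_W: "0 \<le> t \<Longrightarrow> W t \<in> borel_measurable M"
  using wiener by (simp add: wiener_process_def)

definition filtration_gens :: "real \<Rightarrow> 'a set set" where
  "filtration_gens t = {W s -` B \<inter> space M | s B. s \<in> {0..t} \<and> B \<in> sets borel} \<union>
        {J s -` B \<inter> space M | s B. s \<in> {0..t} \<and> B \<in> sets borel} \<union> null_sets M"

lemma filtration_gens_events: "filtration_gens t \<subseteq> events"
  by (auto simp: filtration_gens_def intro!: measurable_sets[of _ M borel] measurable_W measurable_J)

lemma filtration_gens_Pow: "filtration_gens t \<subseteq> Pow (space M)"
  using filtration_gens_events sets.sets_into_space by blast

lemma sets_F: "sets (F t) = sigma_sets (space M) (filtration_gens t)"
  unfolding augmented_filtration_def filtration_gens_def[symmetric] using filtration_gens_Pow by simp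

lemma space_F [simp]: "space (F t) = space M"
  unfolding augmented_filtration_def filtration_gens_def[symmetric] using filtration_gens_Pow
  by (simp add: space_measure_of_conv)

lemma sets_F_mono:
  assumes "s \<le> t"
  shows "sets (F s) \<subseteq> sets (F t)"
proof -
  have "{X r -` B \<inter> space M | r B. r \<in> {0..s} \<and> B \<in> sets borel} \<subseteq>
      {X r -` B \<inter> space M | r B. r \<in> {0..t} \<and> B \<in> sets borel}" for X :: "'a process"
    using assms by (intro Collect_mono impI) (metis atLeastAtMost_iff order_trans)
  then have "filtration_gens s \<subseteq> filtration_gens t" unfolding filtration_gens_def by (intro Un_mono subset_refl)
  then show ?thesis unfolding sets_F by (rule sigma_sets_mono')
qed

lemma sets_F_events: "sets (F t) \<subseteq> events"
  unfolding sets_F using filtration_gens_events by (rule sets.sigma_sets_subset)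

lemma measurable_F_mono: "s \<le> t \<Longrightarrow> X \<in> measurable (F s) N \<Longrightarrow> X \<in> measurable (F t) N"
  using sets_F_mono[of s t] by (auto simp: measurable_def)

lemma measurable_F_imp_measurable: "X \<in> measurable (F t) N \<Longrightarrow> X \<in> measurable M N"
  using sets_F_events[of t] by (auto simp: measurable_def)

lemma measurable_W_F: "0 \<le> s \<Longrightarrow> s \<le> t \<Longrightarrow> W s \<in> borel_measurable (F t)"
  by (rule measurableI) (auto simp: sets_F filtration_gens_def intro!: sigma_sets.Basic)

section \<open>Increments of the Wiener process are independent of the past\<close>

definition cylinder :: "'a process \<Rightarrow> real set \<Rightarrow> (real \<Rightarrow> real set) \<Rightarrow> 'a set" where
  "cylinder X K B = {\<omega>\<in>space M. \<forall>u\<in>K. X u \<omega> \<in> B u}"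

lemma cylinder_event:
  assumes "finite K" and "\<And>u. B u \<in> sets borel"
    and "\<And>u. u \<in> K \<Longrightarrow> X u \<in> borel_measurable M"
  shows "cylinder X K B \<in> events"
  unfolding cylinder_def
proof (rule sets.sets_Collect_finite_All)
  fix u assume "u \<in> K"
  from measurable_sets_Collect[OF assms(3)[OF this], of "\<lambda>x. x \<in> B u"] assms(2)[of u]
  show "{\<omega> \<in> space M. X u \<omega> \<in> B u} \<in> events" by simp
qed fact

text \<open>
  Up to the null event \<open>W\<^sub>0 \<noteq> 0\<close>, the values of \<open>W\<close> on a finite set of times in \<open>[0,s]\<close> are partial sums of
  the increments along the ordered set of these times. Adding the times \<open>0\<close>, \<open>s\<close> and \<open>t\<close> to the grid makes
  \<open>W\<^sub>t - W\<^sub>s\<close> the last increment, which is independent of all earlier ones.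
\<close>

lemma W_cylinder_indep_increment:
  assumes K: "finite K" "K \<subseteq> {0..s}" and s: "0 \<le> s" "s < t"
    and B: "\<And>u. B u \<in> sets borel" and C: "C \<in> sets borel"
  shows "prob (cylinder W K B \<inter> {\<omega>\<in>space M. W t \<omega> - W s \<omega> \<in> C}) =
    prob (cylinder W K B) * prob {\<omega>\<in>space M. W t \<omega> - W s \<omega> \<in> C}"
proof -
  define K' where "K' = insert 0 (insert s K)"
  define L where "L = sorted_list_of_set K'"
  have K': "finite K'" "K' \<subseteq> {0..s}" "0 \<in> K'" "s \<in> K'" using K s by (auto simp: K'_def)
  have L: "set L = K'" "sorted_wrt (<) L" using K' by (auto simp: L_def)
  obtain N where N: "length L = Suc N"
    using L K' by (cases L) auto
  have mono: "L ! i < L ! k" if "i < k" "k \<le> N" for i k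
    using that N by (auto intro!: sorted_wrt_nth_less[OF L(2)])
  have mem: "L ! i \<in> K'" if "i \<le> N" for i
    using that N L by (metis less_Suc_eq_le nth_mem)
  have L0: "L ! 0 = 0"
  proof -
    obtain i where i: "i \<le> N" "L ! i = 0"
      using K' L N by (metis in_set_conv_nth less_Suc_eq_le)
    have "0 \<le> L ! 0" using mem[of 0] K' by auto
    with i mono[of 0 i] show ?thesis by (cases "i = 0") auto
  qed
  have LN: "L ! N = s"
  proof -
    obtain i where i: "i \<le> N" "L ! i = s"
      using K' L N by (metis in_set_conv_nth less_Suc_eq_le)
    have "L ! N \<le> s" using mem[of N] K' by auto
    with i mono[of i N] show ?thesis by (cases "i = N") auto
  qed
  define \<tau> where "\<tau> i = (if i \<le> N then L ! i else t)" for i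
  have sm: "strict_mono_on {..Suc N} \<tau>"
  proof (rule strict_mono_onI)
    fix i k assume *: "i \<in> {..Suc N}" "k \<in> {..Suc N}" "i < k"
    show "\<tau> i < \<tau> k"
    proof (cases "k \<le> N")
      case True then show ?thesis using * mono by (simp add: \<tau>_def)
    next
      case False
      then have "L ! i \<le> s" using * mem[of i] K' by auto
      then show ?thesis using * False s by (simp add: \<tau>_def)
    qed
  qed
  have \<tau>0: "\<tau> 0 = 0" using L0 by (simp add: \<tau>_def)
  define X where "X i \<omega> = W (\<tau> (Suc i)) \<omega> - W (\<tau> i) \<omega>" for i \<omega>
  have "indep_vars (\<lambda>_. borel) X {..<Suc N}"
    using wiener sm \<tau>0 unfolding wiener_process_def independent_increments_def X_def by auto
  then have "indep_var (PiM {..<N} (\<lambda>_. borel)) (\<lambda>\<omega>. restrict (\<lambda>i. X i \<omega>) {..<N})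
      (PiM {N} (\<lambda>_. borel)) (\<lambda>\<omega>. restrict (\<lambda>i. X i \<omega>) {N})"
    by (rule indep_var_restrict) auto
  moreover define past where "past = (\<lambda>\<omega>. restrict (\<lambda>i. X i \<omega>) {..<N})"
  moreover define fresh where "fresh = (\<lambda>\<omega>. restrict (\<lambda>i. X i \<omega>) {N})"
  ultimately have ind: "indep_var (PiM {..<N} (\<lambda>_. borel)) past (PiM {N} (\<lambda>_. borel)) fresh"
    by simp
  \<comment> \<open>The cylinder condition on \<open>W\<close>, rewritten as a condition on the vector of increments.\<close>
  define E where "E = {x\<in>space (PiM {..<N} (\<lambda>_. borel::real measure)).
      \<forall>i\<in>{..N}. \<tau> i \<in> K \<longrightarrow> (\<Sum>j<i. x j) \<in> B (\<tau> i)}"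
  define C' where "C' = {x\<in>space (PiM {N} (\<lambda>_. borel::real measure)). x N \<in> C}"
  have "E \<in> sets (PiM {..<N} (\<lambda>_. borel))"
    unfolding E_def
  proof (rule sets.sets_Collect_finite_All)
    fix i assume i: "i \<in> {..N}"
    have "(\<lambda>x. \<Sum>j<i. x j) \<in> borel_measurable (PiM {..<N} (\<lambda>_. borel::real measure))"
      using i by (intro borel_measurable_sum measurable_component_singleton) auto
    from measurable_sets_Collect[OF this, of "\<lambda>x. x \<in> B (\<tau> i)"] B[of "\<tau> i"]
    show "{x \<in> space (PiM {..<N} (\<lambda>_. borel::real measure)). \<tau> i \<in> K \<longrightarrow> (\<Sum>j<i. x j) \<in> B (\<tau> i)}
      \<in> sets (PiM {..<N} (\<lambda>_. borel))"
      by (cases "\<tau> i \<in> K") simp_all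
  qed simp
  note E = this
  have C': "C' \<in> sets (PiM {N} (\<lambda>_. borel))" unfolding C'_def
    using measurable_sets_Collect[OF measurable_component_singleton, of N "{N}" "\<lambda>_. borel" "\<lambda>x. x \<in> C"] C
    by simp
  have tele: "(\<Sum>j<i. X j \<omega>) = W (\<tau> i) \<omega> - W 0 \<omega>" for i \<omega>
    unfolding X_def using sum_lessThan_telescope[of "\<lambda>i. W (\<tau> i) \<omega>" i] \<tau>0 by simp
  have XN: "X N \<omega> = W t \<omega> - W s \<omega>" for \<omega> using LN by (simp add: X_def \<tau>_def)
  let ?E = "{\<omega>\<in>space M. \<forall>i\<in>{..N}. \<tau> i \<in> K \<longrightarrow> W (\<tau> i) \<omega> - W 0 \<omega> \<in> B (\<tau> i)}"
  let ?D = "{\<omega>\<in>space M. W t \<omega> - W s \<omega> \<in> C}"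
  have preE: "past -` E \<inter> space M = ?E"
  proof -
    have "(\<Sum>j<i. past \<omega> j) = W (\<tau> i) \<omega> - W 0 \<omega>" if "i \<le> N" for i \<omega>
      unfolding tele[symmetric] using that by (intro sum.cong) (auto simp: past_def)
    moreover have "past \<omega> \<in> space (PiM {..<N} (\<lambda>_. borel))" for \<omega>
      by (simp add: past_def space_PiM)
    ultimately show ?thesis by (simp add: E_def set_eq_iff conj_commute)
  qed
  have preC: "fresh -` C' \<inter> space M = ?D"
  proof -
    have "fresh \<omega> N = W t \<omega> - W s \<omega>" for \<omega> by (simp add: fresh_def XN)
    moreover have "fresh \<omega> \<in> space (PiM {N} (\<lambda>_. borel))" for \<omega>
      by (simp add: fresh_def space_PiM)
    ultimately show ?thesis by (simp add: C'_def set_eq_iff conj_commute)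
  qed
  have "(\<lambda>\<omega>. (past \<omega>, fresh \<omega>)) -` (E \<times> C') \<inter> space M = ?E \<inter> ?D"
    unfolding preE[symmetric] preC[symmetric] by blast
  then have "prob (?E \<inter> ?D) = prob ?E * prob ?D"
    using indep_varD[OF ind E C'] unfolding preE preC by simp
  moreover have ae: "AE \<omega> in M. \<omega> \<in> ?E \<longleftrightarrow> \<omega> \<in> cylinder W K B"
  proof -
    have *: "AE \<omega> in M. W 0 \<omega> = 0" using wiener by (simp add: wiener_process_def)
    have ex: "\<exists>i\<in>{..N}. \<tau> i = u" if "u \<in> K" for u
    proof -
      have "u \<in> set L" using that L by (simp add: K'_def)
      then obtain i where "i < length L" "L ! i = u" unfolding in_set_conv_nth by blast
      then have "i \<in> {..N}" "\<tau> i = u" using N by (simp_all add: \<tau>_def)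
      then show ?thesis by blast
    qed
    have eq: "(\<forall>i\<in>{..N}. \<tau> i \<in> K \<longrightarrow> W (\<tau> i) \<omega> \<in> B (\<tau> i)) \<longleftrightarrow> (\<forall>u\<in>K. W u \<omega> \<in> B u)" for \<omega>
      using ex by fast
    show ?thesis using * by (rule eventually_mono) (simp add: cylinder_def eq)
  qed
  moreover have m: "?E \<in> events" "?D \<in> events" "cylinder W K B \<in> events"
  proof -
    have "past \<in> measurable M (PiM {..<N} (\<lambda>_. borel))"
      using ind by (rule indep_var_rv1)
    from measurable_sets[OF this E] show "?E \<in> events" unfolding preE .
    have "fresh \<in> measurable M (PiM {N} (\<lambda>_. borel))"
      using ind by (rule indep_var_rv2)
    from measurable_sets[OF this C'] show "?D \<in> events" unfolding preC .
    show "cylinder W K B \<in> events" using K B by (intro cylinder_event measurable_W) auto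
  qed
  moreover have "prob ?E = prob (cylinder W K B)"
    using ae m by (intro finite_measure_eq_AE) auto
  moreover have "prob (?E \<inter> ?D) = prob (cylinder W K B \<inter> ?D)"
    using ae m by (intro finite_measure_eq_AE) auto
  ultimately show ?thesis by simp
qed

lemma coordinate_cylinder_sets:
  fixes K :: "real set"
  assumes "finite K" "K \<subseteq> {0..}" "\<And>u. B u \<in> sets borel"
  shows "{w\<in>space (PiM {0..} (\<lambda>_. borel :: real measure)). \<forall>u\<in>K. w u \<in> B u} \<in> sets (PiM {0..} (\<lambda>_. borel))"
proof (rule sets.sets_Collect_finite_All)
  fix u assume "u \<in> K"
  then have "(\<lambda>w. w u) \<in> borel_measurable (PiM {0..} (\<lambda>_. borel :: real measure))"
    using assms by (intro measurable_component_singleton) auto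
  from measurable_sets_Collect[OF this, of "\<lambda>x. x \<in> B u"] assms(3)[of u]
  show "{w \<in> space (PiM {0..} (\<lambda>_. borel :: real measure)). w u \<in> B u} \<in> sets (PiM {0..} (\<lambda>_. borel))"
    by simp
qed fact

text \<open>
  Independence of the whole processes separates the condition on \<open>J\<close> from everything that concerns
  \<open>W\<close>, both with and without the condition on the increment. What remains is a statement about \<open>W\<close>
  alone.
\<close>

lemma WJ_cylinder_indep_increment:
  assumes K: "finite K" "K \<subseteq> {0..s}" and K': "finite K'" "K' \<subseteq> {0..s}"
    and s: "0 \<le> s" "s < t"
    and B: "\<And>u. B u \<in> sets borel" "\<And>u. B' u \<in> sets borel" and C: "C \<in> sets borel"
  shows "prob (cylinder W K B \<inter> cylinder J K' B' \<inter> {\<omega>\<in>space M. W t \<omega> - W s \<omega> \<in> C}) =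
    prob (cylinder W K B \<inter> cylinder J K' B') * prob {\<omega>\<in>space M. W t \<omega> - W s \<omega> \<in> C}"
proof -
  let ?P = "PiM {0..} (\<lambda>_. borel :: real measure)"
  let ?D = "{\<omega>\<in>space M. W t \<omega> - W s \<omega> \<in> C}"
  define w where "w = (\<lambda>\<omega>. \<lambda>t\<in>{0..}. W t \<omega>)"
  define j where "j = (\<lambda>\<omega>. \<lambda>t\<in>{0..}. J t \<omega>)"
  have ind: "indep_var ?P w ?P j"
    using indep_W_J unfolding independent_processes_def w_def j_def .
  have sp: "w \<omega> \<in> space ?P" "j \<omega> \<in> space ?P" for \<omega>
    by (simp_all add: w_def j_def space_PiM)
  define E where "E = {x\<in>space ?P. \<forall>u\<in>K. x u \<in> B u}"
  define E' where "E' = {x\<in>space ?P. \<forall>u\<in>K'. x u \<in> B' u}"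
  define D where "D = {x\<in>space ?P. x t - x s \<in> C}"
  have sub: "K \<subseteq> {0..}" "K' \<subseteq> {0..}" using K K' by auto
  have E: "E \<in> sets ?P" "E' \<in> sets ?P" unfolding E_def E'_def
    using K K' B sub by (auto intro!: coordinate_cylinder_sets)
  have D: "D \<in> sets ?P" unfolding D_def
  proof -
    have "(\<lambda>x. x t - x s) \<in> borel_measurable ?P"
      using s by (intro borel_measurable_diff measurable_component_singleton) auto
    from measurable_sets_Collect[OF this, of "\<lambda>x. x \<in> C"] C
    show "{x\<in>space ?P. x t - x s \<in> C} \<in> sets ?P" by simp
  qed
  have wu: "w \<omega> u = W u \<omega>" "j \<omega> u = J u \<omega>" if "0 \<le> u" for \<omega> u
    using that by (simp_all add: w_def j_def)
  have "(\<forall>u\<in>K. w \<omega> u \<in> B u) \<longleftrightarrow> (\<forall>u\<in>K. W u \<omega> \<in> B u)" for \<omega>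
    using sub wu by (intro ball_cong) auto
  then have preE: "w -` E \<inter> space M = cylinder W K B"
    by (simp add: E_def cylinder_def sp set_eq_iff conj_commute)
  have "(\<forall>u\<in>K'. j \<omega> u \<in> B' u) \<longleftrightarrow> (\<forall>u\<in>K'. J u \<omega> \<in> B' u)" for \<omega>
    using sub wu by (intro ball_cong) auto
  then have preE': "j -` E' \<inter> space M = cylinder J K' B'"
    by (simp add: E'_def cylinder_def sp set_eq_iff conj_commute)
  have preD: "w -` D \<inter> space M = ?D"
    using s by (simp add: D_def sp wu set_eq_iff conj_commute)
  have split: "prob ((w -` A \<inter> space M) \<inter> (j -` E' \<inter> space M)) =
      prob (w -` A \<inter> space M) * prob (j -` E' \<inter> space M)" if "A \<in> sets ?P" for A
  proof -
    have "(\<lambda>\<omega>. (w \<omega>, j \<omega>)) -` (A \<times> E') \<inter> space M =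
        (w -` A \<inter> space M) \<inter> (j -` E' \<inter> space M)" by blast
    then show ?thesis using indep_varD[OF ind that E(2)] by simp
  qed
  have "E \<inter> D \<in> sets ?P" using E D by blast
  moreover have "w -` (E \<inter> D) \<inter> space M = cylinder W K B \<inter> ?D"
    unfolding preE[symmetric] preD[symmetric] by blast
  ultimately have "prob ((cylinder W K B \<inter> ?D) \<inter> cylinder J K' B') = prob (cylinder W K B \<inter> ?D) * prob (cylinder J K' B')"
    using split[of "E \<inter> D"] unfolding preE' by simp
  moreover have "prob (cylinder W K B \<inter> cylinder J K' B') = prob (cylinder W K B) * prob (cylinder J K' B')"
    using split[OF E(1)] unfolding preE preE' .
  moreover have "(cylinder W K B \<inter> ?D) \<inter> cylinder J K' B' = cylinder W K B \<inter> cylinder J K' B' \<inter> ?D" by blast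
  ultimately show ?thesis
    using W_cylinder_indep_increment[OF K s B(1) C] by simp
qed

text \<open>
  A generator of the past up to time \<open>s\<close> that is closed under intersections. The null sets have to be
  kept as a separate part: they are independent of everything, but they are not cylinders.
\<close>

definition cylinder_gens :: "real \<Rightarrow> 'a set set" where
  "cylinder_gens s = {cylinder W K B \<inter> cylinder J K' B' | K B K' B'. finite K \<and> K \<subseteq> {0..s} \<and> finite K' \<and> K' \<subseteq> {0..s} \<and>
      (\<forall>u. B u \<in> sets borel) \<and> (\<forall>u. B' u \<in> sets borel)} \<union> null_sets M"

text \<open>
  Both cylinders are first extended to the common set of times by the trivial condition \<open>UNIV\<close>.
\<close>

lemma cylinder_Int:
  "cylinder X K B \<inter> cylinder X L C =
    cylinder X (K \<union> L) (\<lambda>u. (if u \<in> K then B u else UNIV) \<inter> (if u \<in> L then C u else UNIV))"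
  by (auto simp: cylinder_def)

lemma cylinder_gensI:
  assumes "finite K" "K \<subseteq> {0..s}" "finite K'" "K' \<subseteq> {0..s}"
    "\<And>u. B u \<in> sets borel" "\<And>u. B' u \<in> sets borel"
  shows "cylinder W K B \<inter> cylinder J K' B' \<in> cylinder_gens s"
  unfolding cylinder_gens_def using assms by blast

lemma cylinder_gensE:
  assumes "A \<in> cylinder_gens s"
  obtains (cyl) K B K' B' where "A = cylinder W K B \<inter> cylinder J K' B'"
    "finite K" "K \<subseteq> {0..s}" "finite K'" "K' \<subseteq> {0..s}"
    "\<And>u. B u \<in> sets borel" "\<And>u. B' u \<in> sets borel"
  | (null) "A \<in> null_sets M"
  using assms unfolding cylinder_gens_def by blast

lemma cylinder_gens_events:
  assumes "0 \<le> s" shows "cylinder_gens s \<subseteq> events"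
proof
  fix A assume "A \<in> cylinder_gens s"
  then show "A \<in> events"
  proof (cases rule: cylinder_gensE)
    case (cyl K B K' B')
    have "cylinder W K B \<in> events" "cylinder J K' B' \<in> events"
      using cyl by (auto intro!: cylinder_event measurable_W measurable_J)
    then show ?thesis using cyl by blast
  qed auto
qed

lemma Int_stable_pi_gens:
  assumes "0 \<le> s" shows "Int_stable (cylinder_gens s)"
proof (rule Int_stableI)
  fix A C assume AC: "A \<in> cylinder_gens s" "C \<in> cylinder_gens s"
  have ev: "A \<in> events" "C \<in> events" using AC cylinder_gens_events[OF assms] by auto
  show "A \<inter> C \<in> cylinder_gens s"
  proof (cases "A \<in> null_sets M \<or> C \<in> null_sets M")
    case True
    then have "A \<inter> C \<in> null_sets M" using ev null_set_Int1 null_set_Int2 by blast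
    then show ?thesis by (simp add: cylinder_gens_def)
  next
    case False
    obtain K B K' B' where A: "A = cylinder W K B \<inter> cylinder J K' B'"
      "finite K" "K \<subseteq> {0..s}" "finite K'" "K' \<subseteq> {0..s}"
      "\<And>u. B u \<in> sets borel" "\<And>u. B' u \<in> sets borel"
      using AC(1) False by (cases rule: cylinder_gensE) auto
    obtain L D L' D' where C: "C = cylinder W L D \<inter> cylinder J L' D'"
      "finite L" "L \<subseteq> {0..s}" "finite L'" "L' \<subseteq> {0..s}"
      "\<And>u. D u \<in> sets borel" "\<And>u. D' u \<in> sets borel"
      using AC(2) False by (cases rule: cylinder_gensE) auto
    have "A \<inter> C = (cylinder W K B \<inter> cylinder W L D) \<inter> (cylinder J K' B' \<inter> cylinder J L' D')"
      unfolding A C by blast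
    also have "\<dots> \<in> cylinder_gens s"
      unfolding cylinder_Int using A(2-) C(2-) by (intro cylinder_gensI) auto
    finally show ?thesis .
  qed
qed

lemma gens_subset_pi_gens:
  assumes "0 \<le> s" shows "filtration_gens s \<subseteq> cylinder_gens s"
proof
  fix A assume "A \<in> filtration_gens s"
  then consider (W) r B where "A = W r -` B \<inter> space M" "r \<in> {0..s}" "B \<in> sets borel"
    | (J) r B where "A = J r -` B \<inter> space M" "r \<in> {0..s}" "B \<in> sets borel"
    | (null) "A \<in> null_sets M"
    unfolding filtration_gens_def by blast
  then show "A \<in> cylinder_gens s"
  proof cases
    case W
    then have "A = cylinder W {r} (\<lambda>_. B) \<inter> cylinder J {} (\<lambda>_. UNIV)" by (auto simp: cylinder_def)
    also have "\<dots> \<in> cylinder_gens s" using W by (intro cylinder_gensI) auto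
    finally show ?thesis .
  next
    case J
    then have "A = cylinder W {} (\<lambda>_. UNIV) \<inter> cylinder J {r} (\<lambda>_. B)" by (auto simp: cylinder_def)
    also have "\<dots> \<in> cylinder_gens s" using J by (intro cylinder_gensI) auto
    finally show ?thesis .
  next
    case null
    then show ?thesis by (simp add: cylinder_gens_def)
  qed
qed

text \<open>
  Cylinders are independent of the increment by the preceding computation, null sets trivially so.
  Independence passes from the intersection-stable generator to the generated \<open>\<sigma>\<close>-algebra.
\<close>

lemma increment_indep_of_past:
  assumes s: "0 \<le> s" "s < t" and X: "X \<in> measurable (F s) N"
  shows "indep_var N X borel (\<lambda>\<omega>. W t \<omega> - W s \<omega>)"
proof -
  let ?D = "\<lambda>\<omega>. W t \<omega> - W s \<omega>"
  let ?Ds = "{?D -` C \<inter> space M | C. C \<in> sets borel}"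
  have D: "?D \<in> borel_measurable M" using s by (intro borel_measurable_diff measurable_W) auto
  have "indep_set (cylinder_gens s) ?Ds"
  proof (rule indep_setI)
    show "cylinder_gens s \<subseteq> events" using s by (intro cylinder_gens_events)
    show "?Ds \<subseteq> events" using D by (auto intro: measurable_sets)
    fix A B assume A: "A \<in> cylinder_gens s" and "B \<in> ?Ds"
    then obtain C where C: "B = ?D -` C \<inter> space M" "C \<in> sets borel" by blast
    then have B: "B = {\<omega>\<in>space M. ?D \<omega> \<in> C}" by blast
    have Bev: "B \<in> events" using C D by (auto intro: measurable_sets)
    from A show "prob (A \<inter> B) = prob A * prob B"
    proof (cases rule: cylinder_gensE)
      case cyl
      then show ?thesis using WJ_cylinder_indep_increment[OF cyl(2-5) s cyl(6,7) C(2)] B by simp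
    next
      case null
      then have "A \<inter> B \<in> null_sets M" using Bev by (rule null_set_Int2)
      then show ?thesis using null by (simp add: measure_eq_0_null_sets)
    qed
  qed
  moreover have "Int_stable ?Ds"
  proof (rule Int_stableI)
    fix A B assume "A \<in> ?Ds" "B \<in> ?Ds"
    then obtain C E where "A = ?D -` C \<inter> space M" "C \<in> sets borel" "B = ?D -` E \<inter> space M" "E \<in> sets borel"
      by blast
    then have "A \<inter> B = ?D -` (C \<inter> E) \<inter> space M" "C \<inter> E \<in> sets borel" by auto
    then show "A \<inter> B \<in> ?Ds" by blast
  qed
  ultimately have ind: "indep_set (sigma_sets (space M) (cylinder_gens s)) (sigma_sets (space M) ?Ds)"
    using Int_stable_pi_gens s(1) by (intro indep_set_sigma_sets)
  have "sets (F s) \<subseteq> sigma_sets (space M) (cylinder_gens s)"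
    unfolding sets_F using gens_subset_pi_gens[OF s(1)] by (rule sigma_sets_mono')
  moreover have "sigma_sets (space M) {X -` A \<inter> space M | A. A \<in> sets N} \<subseteq> sets (F s)"
  proof -
    have "{X -` A \<inter> space M | A. A \<in> sets N} \<subseteq> sets (F s)"
      using measurable_sets[OF X] by auto
    from sets.sigma_sets_subset[OF this] show ?thesis by simp
  qed
  ultimately have "sigma_sets (space M) {X -` A \<inter> space M | A. A \<in> sets N} \<subseteq> sigma_sets (space M) (cylinder_gens s)"
    by blast
  with ind have "indep_set (sigma_sets (space M) {X -` A \<inter> space M | A. A \<in> sets N}) (sigma_sets (space M) ?Ds)"
    unfolding indep_sets2_eq by blast
  then show ?thesis
    unfolding indep_var_eq using D measurable_F_imp_measurable[OF X] by blast
qed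

lemma increment_moments:
  assumes "0 \<le> s" "s < t"
  shows "integrable M (\<lambda>\<omega>. W t \<omega> - W s \<omega>)" "expectation (\<lambda>\<omega>. W t \<omega> - W s \<omega>) = 0"
    "integrable M (\<lambda>\<omega>. (W t \<omega> - W s \<omega>)\<^sup>2)" "expectation (\<lambda>\<omega>. (W t \<omega> - W s \<omega>)\<^sup>2) = t - s"
proof -
  have D: "distributed M lborel (\<lambda>\<omega>. W t \<omega> - W s \<omega>) (normal_density 0 (sqrt (t - s)))"
    using wiener assms by (simp add: wiener_process_def)
  have pos: "0 < sqrt (t - s)" using assms by simp
  show "integrable M (\<lambda>\<omega>. W t \<omega> - W s \<omega>)"
    using distributed_integrable[OF D, of "\<lambda>x. x"] integrable_normal_moment[OF pos, of 0 1] by simp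
  show 0: "expectation (\<lambda>\<omega>. W t \<omega> - W s \<omega>) = 0"
    by (rule normal_distributed_expectation[OF pos D])
  show "integrable M (\<lambda>\<omega>. (W t \<omega> - W s \<omega>)\<^sup>2)"
    using distributed_integrable[OF D, of "\<lambda>x. x\<^sup>2"] integrable_normal_moment[OF pos, of 0 2] by simp
  show "expectation (\<lambda>\<omega>. (W t \<omega> - W s \<omega>)\<^sup>2) = t - s"
    using normal_distributed_variance[OF pos D] 0 assms by simp
qed

section \<open>Stochastic integrals of simple processes\<close>

text \<open>
  The two facts behind the isometry: increments of \<open>W\<close> stopped at \<open>t\<close> are centred given the past, and
  their conditional second moment is the length of the stopped time interval. If \<open>t \<le> r\<close> the increment
  and the length both vanish; otherwise \<open>X\<close> is known at the left end of the stopped interval, and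
  independence applies.
\<close>

lemma stopped_increment_mult:
  fixes X :: "'a \<Rightarrow> real" and t :: real
  assumes "0 \<le> r" "r < r'" and X: "X \<in> borel_measurable (F r)" "integrable M X"
  defines "D \<equiv> \<lambda>\<omega>. W (min t r') \<omega> - W (min t r) \<omega>"
  shows "integrable M (\<lambda>\<omega>. X \<omega> * D \<omega>)" "expectation (\<lambda>\<omega>. X \<omega> * D \<omega>) = 0"
    "integrable M (\<lambda>\<omega>. X \<omega> * (D \<omega>)\<^sup>2)"
    "expectation (\<lambda>\<omega>. X \<omega> * (D \<omega>)\<^sup>2) = expectation X * (min t r' - min t r)"
proof -
  have "integrable M (\<lambda>\<omega>. X \<omega> * D \<omega>) \<and> expectation (\<lambda>\<omega>. X \<omega> * D \<omega>) = 0 \<and>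
    integrable M (\<lambda>\<omega>. X \<omega> * (D \<omega>)\<^sup>2) \<and>
    expectation (\<lambda>\<omega>. X \<omega> * (D \<omega>)\<^sup>2) = expectation X * (min t r' - min t r)"
  proof (cases "t \<le> r")
    case True
    then show ?thesis using assms by (simp add: D_def)
  next
    case False
    then have D: "D = (\<lambda>\<omega>. W (min t r') \<omega> - W r \<omega>)" and m: "r < min t r'"
      using assms by (auto simp: D_def min_def)
    note mom = increment_moments[OF \<open>0 \<le> r\<close> m, folded D]
    have ind: "indep_var borel X borel D"
      unfolding D by (rule increment_indep_of_past) fact+
    have ind2: "indep_var borel X borel (\<lambda>\<omega>. (D \<omega>)\<^sup>2)"
      using indep_var_compose[OF ind, of "\<lambda>x. x" borel "\<lambda>x. x\<^sup>2" borel] by (simp add: comp_def)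
    have min: "min t r = r" using False by simp
    show ?thesis
      using indep_var_integrable[OF ind X(2)] indep_var_lebesgue_integral[OF ind X(2)]
        indep_var_integrable[OF ind2 X(2)] indep_var_lebesgue_integral[OF ind2 X(2)] mom
      by (simp add: D min)
  qed
  then show "integrable M (\<lambda>\<omega>. X \<omega> * D \<omega>)" "expectation (\<lambda>\<omega>. X \<omega> * D \<omega>) = 0"
    "integrable M (\<lambda>\<omega>. X \<omega> * (D \<omega>)\<^sup>2)"
    "expectation (\<lambda>\<omega>. X \<omega> * (D \<omega>)\<^sup>2) = expectation X * (min t r' - min t r)"
    by auto
qed

lemma simple_times_nonneg:
  assumes "is_simple_process M F (k, \<tau>, \<xi>)" "i \<le> k"
  shows "0 \<le> \<tau> i"
proof -
  have "\<tau> 0 \<le> \<tau> i"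
    using assms by (auto intro: strict_mono_on_leD)
  then show ?thesis using assms by simp
qed

lemma simple_integral_adapted:
  assumes "is_simple_process M F (k, \<tau>, \<xi>)" "0 \<le> t"
  shows "simple_integral W (k, \<tau>, \<xi>) t \<in> borel_measurable (F (\<tau> k))"
proof -
  have "(\<lambda>\<omega>. \<Sum>i<k. \<xi> i \<omega> * (W (min t (\<tau> (Suc i))) \<omega> - W (min t (\<tau> i)) \<omega>)) \<in> borel_measurable (F (\<tau> k))"
  proof (intro borel_measurable_sum borel_measurable_times borel_measurable_diff)
    fix i assume i: "i \<in> {..<k}"
    have mono: "\<tau> i \<le> \<tau> k" "\<tau> (Suc i) \<le> \<tau> k"
      using assms(1) i by (auto intro!: strict_mono_on_leD[of "{..k}" \<tau>])
    have pos: "0 \<le> \<tau> i" "0 \<le> \<tau> (Suc i)" using simple_times_nonneg[OF assms(1)] i by auto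
    show "\<xi> i \<in> borel_measurable (F (\<tau> k))"
      using assms(1) i mono by (auto intro: measurable_F_mono)
    show "W (min t (\<tau> (Suc i))) \<in> borel_measurable (F (\<tau> k))" "W (min t (\<tau> i)) \<in> borel_measurable (F (\<tau> k))"
      using mono pos assms(2) by (auto intro!: measurable_W_F)
  qed
  moreover have "simple_integral W (k, \<tau>, \<xi>) t =
      (\<lambda>\<omega>. \<Sum>i<k. \<xi> i \<omega> * (W (min t (\<tau> (Suc i))) \<omega> - W (min t (\<tau> i)) \<omega>))"
    by (rule ext) simp
  ultimately show ?thesis by simp
qed

text \<open>
  In the square of the sum, the mixed term of the last increment and the preceding partial sum has
  mean zero, because the latter is known when the last increment begins.
\<close>

lemma simple_ito_isometry:
  assumes "is_simple_process M F (k, \<tau>, \<xi>)" "0 \<le> t"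
  shows "integrable M (\<lambda>\<omega>. (simple_integral W (k, \<tau>, \<xi>) t \<omega>)\<^sup>2) \<and>
    expectation (\<lambda>\<omega>. (simple_integral W (k, \<tau>, \<xi>) t \<omega>)\<^sup>2) =
      expectation (\<lambda>\<omega>. \<Sum>i<k. (\<xi> i \<omega>)\<^sup>2 * (min t (\<tau> (Suc i)) - min t (\<tau> i)))"
  using assms(1)
proof (induction k)
  case 0
  then show ?case by simp
next
  case (Suc k)
  have Sk: "is_simple_process M F (k, \<tau>, \<xi>)"
    using Suc.prems by (auto intro: monotone_on_subset)
  define S where "S = simple_integral W (k, \<tau>, \<xi>) t"
  define D where "D \<omega> = W (min t (\<tau> (Suc k))) \<omega> - W (min t (\<tau> k)) \<omega>" for \<omega>
  define Q where "Q = (\<lambda>\<omega>. \<Sum>i<k. (\<xi> i \<omega>)\<^sup>2 * (min t (\<tau> (Suc i)) - min t (\<tau> i)))"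
  note IH = Suc.IH[OF Sk, folded S_def Q_def]
  have \<tau>: "0 \<le> \<tau> k" "\<tau> k < \<tau> (Suc k)"
    using simple_times_nonneg[OF Sk] Suc.prems by (auto elim!: strict_mono_onD)
  have \<xi>F: "\<xi> i \<in> borel_measurable (F (\<tau> i))" if "i \<le> k" for i using Suc.prems that by auto
  have \<xi>M: "\<xi> i \<in> borel_measurable M" if "i \<le> k" for i
    using \<xi>F[OF that] by (rule measurable_F_imp_measurable)
  have bound: "\<exists>C. \<forall>\<omega>\<in>space M. \<bar>\<xi> i \<omega>\<bar> \<le> C" if "i \<le> k" for i using Suc.prems that by auto
  have SF: "S \<in> borel_measurable (F (\<tau> k))" using simple_integral_adapted[OF Sk assms(2)] by (simp add: S_def)
  then have SM: "S \<in> borel_measurable M" by (rule measurable_F_imp_measurable)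
  have S: "integrable M S" using IH SM by (blast intro: square_integrable_imp_integrable)
  obtain C where C: "\<And>\<omega>. \<omega> \<in> space M \<Longrightarrow> \<bar>\<xi> k \<omega>\<bar> \<le> C" using bound[of k] by blast
  have S\<xi>: "integrable M (\<lambda>\<omega>. S \<omega> * \<xi> k \<omega>)"
  proof (rule Bochner_Integration.integrable_bound)
    show "integrable M (\<lambda>\<omega>. C * S \<omega>)" using S by simp
    show "AE \<omega> in M. norm (S \<omega> * \<xi> k \<omega>) \<le> norm (C * S \<omega>)"
    proof (rule AE_I2)
      fix \<omega> assume "\<omega> \<in> space M"
      from C[OF this] have "\<bar>\<xi> k \<omega>\<bar> \<le> \<bar>C\<bar>" by linarith
      then show "norm (S \<omega> * \<xi> k \<omega>) \<le> norm (C * S \<omega>)"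
        using mult_left_mono[of "\<bar>\<xi> k \<omega>\<bar>" "\<bar>C\<bar>" "\<bar>S \<omega>\<bar>"] by (simp add: abs_mult mult.commute)
    qed
  qed (use SM \<xi>M[of k] in auto)
  have sq: "integrable M (\<lambda>\<omega>. (\<xi> i \<omega>)\<^sup>2)" if i: "i \<le> k" for i
  proof -
    obtain C where C: "\<And>\<omega>. \<omega> \<in> space M \<Longrightarrow> \<bar>\<xi> i \<omega>\<bar> \<le> C" using bound[OF i] by blast
    have "norm ((\<xi> i \<omega>)\<^sup>2) \<le> C\<^sup>2" if "\<omega> \<in> space M" for \<omega>
      using power_mono[OF C[OF that], of 2] by simp
    then show ?thesis using \<xi>M[OF i] by (intro integrable_const_bound[of _ "C\<^sup>2"] AE_I2) auto
  qed
  have X: "(\<lambda>\<omega>. S \<omega> * \<xi> k \<omega>) \<in> borel_measurable (F (\<tau> k))" "(\<lambda>\<omega>. (\<xi> k \<omega>)\<^sup>2) \<in> borel_measurable (F (\<tau> k))"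
    using SF \<xi>F[of k] by auto
  note cross = stopped_increment_mult(1,2)[OF \<tau> X(1) S\<xi>, of t, folded D_def]
  note diag = stopped_increment_mult(3,4)[OF \<tau> X(2) sq[OF order_refl], of t, folded D_def]
  have exp: "(simple_integral W (Suc k, \<tau>, \<xi>) t \<omega>)\<^sup>2 =
      (S \<omega>)\<^sup>2 + 2 * (S \<omega> * \<xi> k \<omega> * D \<omega>) + (\<xi> k \<omega>)\<^sup>2 * (D \<omega>)\<^sup>2" for \<omega>
  proof -
    have "simple_integral W (Suc k, \<tau>, \<xi>) t \<omega> = S \<omega> + \<xi> k \<omega> * D \<omega>"
      by (simp add: S_def D_def)
    then show ?thesis by (simp only: power2_eq_square) (simp add: algebra_simps)
  qed
  have "integrable M Q" unfolding Q_def using sq by (intro Bochner_Integration.integrable_sum integrable_mult_left) auto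
  then show ?case
    unfolding exp using IH cross diag sq[of k] by (simp add: Q_def)
qed

text \<open>
  At most one of the intervals contains a given time, so the square of the sum is the sum of squares.
\<close>

lemma simple_value_sq_integral:
  assumes "is_simple_process M F (k, \<tau>, \<xi>)" "0 \<le> t"
  shows "(\<integral>\<^sup>+s\<in>{0..t}. ennreal ((simple_value (k, \<tau>, \<xi>) s \<omega>)\<^sup>2) \<partial>lborel) =
    ennreal (\<Sum>i<k. (\<xi> i \<omega>)\<^sup>2 * (min t (\<tau> (Suc i)) - min t (\<tau> i)))"
proof -
  define A where "A i = {min t (\<tau> i)<..min t (\<tau> (Suc i))}" for i
  have mono: "\<tau> i < \<tau> j" if "i < j" "j \<le> k" for i j
    using assms(1) that by (auto elim!: strict_mono_onD)
  have step: "min t (\<tau> i) \<le> min t (\<tau> (Suc i))" if "i < k" for i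
    using mono[of i "Suc i"] that by auto
  have disj: "j = i" if "s \<in> {\<tau> i<..\<tau> (Suc i)}" "s \<in> {\<tau> j<..\<tau> (Suc j)}" "i < k" "j < k" for i j s
  proof (rule ccontr)
    have le: "\<tau> (Suc i) \<le> \<tau> j" if "i < j" "j < k" for i j
      using mono[of "Suc i" j] that by (cases "Suc i = j") auto
    assume "j \<noteq> i"
    then have "i < j \<or> j < i" by auto
    then show False using le[of i j] le[of j i] that by auto
  qed
  have pt: "ennreal ((simple_value (k, \<tau>, \<xi>) s \<omega>)\<^sup>2) * indicator {0..t} s =
      (\<Sum>i<k. ennreal ((\<xi> i \<omega>)\<^sup>2) * indicator (A i) s)" for s
  proof (cases "\<exists>i<k. s \<in> {\<tau> i<..\<tau> (Suc i)}")
    case True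
    then obtain i where i: "i < k" "s \<in> {\<tau> i<..\<tau> (Suc i)}" by blast
    have other: "s \<notin> {\<tau> j<..\<tau> (Suc j)}" if "j \<in> {..<k} - {i}" for j
      using disj[OF i(2), of j] that i by auto
    have "simple_value (k, \<tau>, \<xi>) s \<omega> = (\<Sum>j<k. if j = i then \<xi> i \<omega> else 0)"
      unfolding simple_value.simps by (intro sum.cong refl) (use i other in \<open>auto simp: indicator_def\<close>)
    then have "simple_value (k, \<tau>, \<xi>) s \<omega> = \<xi> i \<omega>" using i by simp
    moreover have "s \<notin> A j" if "j \<in> {..<k} - {i}" for j
      using other[OF that] by (auto simp: A_def)
    then have "(\<Sum>j<k. ennreal ((\<xi> j \<omega>)\<^sup>2) * indicator (A j) s) =
        (\<Sum>j<k. if j = i then ennreal ((\<xi> i \<omega>)\<^sup>2) * indicator (A i) s else 0)"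
      by (intro sum.cong refl) (auto simp: indicator_def)
    then have "(\<Sum>j<k. ennreal ((\<xi> j \<omega>)\<^sup>2) * indicator (A j) s) = ennreal ((\<xi> i \<omega>)\<^sup>2) * indicator (A i) s"
      using i by simp
    moreover have "s \<in> A i \<longleftrightarrow> s \<in> {0..t}"
      using i simple_times_nonneg[OF assms(1), of i] by (auto simp: A_def)
    ultimately show ?thesis by (simp add: indicator_def)
  next
    case False
    then have "simple_value (k, \<tau>, \<xi>) s \<omega> = 0"
      unfolding simple_value.simps by (intro sum.neutral) (auto simp: indicator_def)
    moreover have "(\<Sum>i<k. ennreal ((\<xi> i \<omega>)\<^sup>2) * indicator (A i) s) = 0"
      using False by (intro sum.neutral) (auto simp: A_def indicator_def)
    ultimately show ?thesis by simp
  qed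
  have "(\<integral>\<^sup>+s\<in>{0..t}. ennreal ((simple_value (k, \<tau>, \<xi>) s \<omega>)\<^sup>2) \<partial>lborel) =
      (\<Sum>i<k. \<integral>\<^sup>+s. ennreal ((\<xi> i \<omega>)\<^sup>2) * indicator (A i) s \<partial>lborel)"
    unfolding pt by (rule nn_integral_sum) (simp add: A_def)
  also have "\<dots> = (\<Sum>i<k. ennreal ((\<xi> i \<omega>)\<^sup>2 * (min t (\<tau> (Suc i)) - min t (\<tau> i))))"
  proof (rule sum.cong[OF refl])
    fix i assume "i \<in> {..<k}"
    then have "min t (\<tau> i) \<le> min t (\<tau> (Suc i))" by (intro step) simp
    then show "(\<integral>\<^sup>+s. ennreal ((\<xi> i \<omega>)\<^sup>2) * indicator (A i) s \<partial>lborel) =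
        ennreal ((\<xi> i \<omega>)\<^sup>2 * (min t (\<tau> (Suc i)) - min t (\<tau> i)))"
      by (simp add: A_def nn_integral_cmult_indicator ennreal_mult)
  qed
  also have "\<dots> = ennreal (\<Sum>i<k. (\<xi> i \<omega>)\<^sup>2 * (min t (\<tau> (Suc i)) - min t (\<tau> i)))"
    using step by (intro sum_ennreal mult_nonneg_nonneg) auto
  finally show ?thesis .
qed

lemma simple_tail_event:
  assumes "is_simple_process M F (k, \<tau>, \<xi>)" "0 \<le> t"
  shows "{\<omega>\<in>space M. e \<le> \<bar>simple_integral W (k, \<tau>, \<xi>) t \<omega>\<bar> \<and>
      (\<Sum>i<k. (\<xi> i \<omega>)\<^sup>2 * (min t (\<tau> (Suc i)) - min t (\<tau> i))) \<le> \<delta>} \<in> events"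
proof -
  have [measurable]: "simple_integral W (k, \<tau>, \<xi>) t \<in> borel_measurable M"
    using simple_integral_adapted[OF assms] by (rule measurable_F_imp_measurable)
  have "\<xi> i \<in> borel_measurable M" if "i < k" for i
    using assms that by (auto intro: measurable_F_imp_measurable)
  then have [measurable]:
    "(\<lambda>\<omega>. \<Sum>i<k. (\<xi> i \<omega>)\<^sup>2 * (min t (\<tau> (Suc i)) - min t (\<tau> i))) \<in> borel_measurable M"
    by (intro borel_measurable_sum borel_measurable_times borel_measurable_power borel_measurable_const) auto
  show ?thesis by measurable
qed

text \<open>
  The energy up to and including the interval \<open>i\<close> is known at the beginning \<open>\<tau> i\<close> of that interval. The
  simple process can therefore be replaced by zero on every interval that would push the energy above
  \<open>\<delta>\<close> without losing adaptedness. The new process has energy at most \<open>\<delta>\<close> everywhere and agrees with the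
  old one wherever the total energy is at most \<open>\<delta>\<close>.
\<close>

lemma simple_integral_tail_bound:
  assumes S: "is_simple_process M F (k, \<tau>, \<xi>)" and t: "0 \<le> t" and \<delta>: "0 \<le> \<delta>" and e: "0 < e"
  shows "prob {\<omega>\<in>space M. e \<le> \<bar>simple_integral W (k, \<tau>, \<xi>) t \<omega>\<bar> \<and>
      (\<Sum>i<k. (\<xi> i \<omega>)\<^sup>2 * (min t (\<tau> (Suc i)) - min t (\<tau> i))) \<le> \<delta>} \<le> \<delta> / e\<^sup>2"
proof -
  define d where "d i = min t (\<tau> (Suc i)) - min t (\<tau> i)" for i
  define V where "V i \<omega> = (\<Sum>j<i. (\<xi> j \<omega>)\<^sup>2 * d j)" for i \<omega>
  define \<eta> where "\<eta> i \<omega> = (if V (Suc i) \<omega> \<le> \<delta> then \<xi> i \<omega> else 0)" for i \<omega>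
  have d: "0 \<le> d i" if "i < k" for i
  proof -
    have "\<tau> i < \<tau> (Suc i)" using S that by (auto elim!: strict_mono_onD)
    then show ?thesis by (simp add: d_def)
  qed
  have \<xi>F: "\<xi> j \<in> borel_measurable (F (\<tau> i))" if "j \<le> i" "i < k" for i j
  proof -
    have "\<tau> j \<le> \<tau> i" using S that by (auto intro!: strict_mono_on_leD[of "{..k}" \<tau>])
    then show ?thesis using S that by (auto intro: measurable_F_mono)
  qed
  have VF: "V (Suc i) \<in> borel_measurable (F (\<tau> i))" if "i < k" for i
    unfolding V_def using \<xi>F that
    by (intro borel_measurable_sum borel_measurable_times borel_measurable_power borel_measurable_const) auto
  have \<eta>: "is_simple_process M F (k, \<tau>, \<eta>)"
  proof -
    have "\<eta> i \<in> borel_measurable (F (\<tau> i))" if "i < k" for i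
    proof -
      have [measurable]: "V (Suc i) \<in> borel_measurable (F (\<tau> i))" "\<xi> i \<in> borel_measurable (F (\<tau> i))"
        using VF \<xi>F that by auto
      show ?thesis unfolding \<eta>_def by measurable
    qed
    moreover have "\<exists>C. \<forall>\<omega>\<in>space M. \<bar>\<eta> i \<omega>\<bar> \<le> C" if i: "i < k" for i
    proof -
      have "\<exists>C. \<forall>\<omega>\<in>space M. \<bar>\<xi> i \<omega>\<bar> \<le> C" using S i by auto
      then obtain C where "\<forall>\<omega>\<in>space M. \<bar>\<xi> i \<omega>\<bar> \<le> C" by blast
      then show ?thesis by (intro exI[of _ C]) (force simp: \<eta>_def)
    qed
    ultimately show ?thesis using S by simp
  qed
  \<comment> \<open>The second bound is needed in the induction: the energy added last is only controlled through \<open>V\<close>.\<close>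
  have le: "(\<Sum>i<l. (\<eta> i \<omega>)\<^sup>2 * d i) \<le> \<delta> \<and> (\<Sum>i<l. (\<eta> i \<omega>)\<^sup>2 * d i) \<le> V l \<omega>" if "l \<le> k" for l \<omega>
    using that
  proof (induction l)
    case 0
    then show ?case using \<delta> by (simp add: V_def)
  next
    case (Suc l)
    have "0 \<le> (\<xi> l \<omega>)\<^sup>2 * d l" using d[of l] Suc.prems by simp
    then show ?case using Suc by (auto simp: \<eta>_def V_def)
  qed
  define I where "I = simple_integral W (k, \<tau>, \<eta>) t"
  have iso: "integrable M (\<lambda>\<omega>. (I \<omega>)\<^sup>2)"
      "expectation (\<lambda>\<omega>. (I \<omega>)\<^sup>2) = expectation (\<lambda>\<omega>. \<Sum>i<k. (\<eta> i \<omega>)\<^sup>2 * d i)"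
    using simple_ito_isometry[OF \<eta> t] unfolding I_def d_def by auto
  have exp_le: "expectation (\<lambda>\<omega>. (I \<omega>)\<^sup>2) \<le> \<delta>"
  proof -
    have "expectation (\<lambda>\<omega>. \<Sum>i<k. (\<eta> i \<omega>)\<^sup>2 * d i) \<le> expectation (\<lambda>_. \<delta>)"
      by (rule integral_mono') (use le[of k] \<delta> in auto)
    then show ?thesis using iso by (simp add: prob_space)
  qed
  have IM: "I \<in> borel_measurable M" unfolding I_def
    using simple_integral_adapted[OF \<eta> t] by (rule measurable_F_imp_measurable)
  have sub: "{\<omega>\<in>space M. e \<le> \<bar>simple_integral W (k, \<tau>, \<xi>) t \<omega>\<bar> \<and>
      (\<Sum>i<k. (\<xi> i \<omega>)\<^sup>2 * (min t (\<tau> (Suc i)) - min t (\<tau> i))) \<le> \<delta>} \<subseteq>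
      {\<omega>\<in>space M. e\<^sup>2 \<le> (I \<omega>)\<^sup>2}"
  proof safe
    fix \<omega> assume \<omega>: "e \<le> \<bar>simple_integral W (k, \<tau>, \<xi>) t \<omega>\<bar>"
      "(\<Sum>i<k. (\<xi> i \<omega>)\<^sup>2 * (min t (\<tau> (Suc i)) - min t (\<tau> i))) \<le> \<delta>"
    then have "V k \<omega> \<le> \<delta>" by (simp add: V_def d_def)
    moreover have "V (Suc i) \<omega> \<le> V k \<omega>" if "i < k" for i
      unfolding V_def using that d by (intro sum_mono2) auto
    ultimately have "\<eta> i \<omega> = \<xi> i \<omega>" if "i < k" for i using that by (force simp: \<eta>_def)
    then have "I \<omega> = simple_integral W (k, \<tau>, \<xi>) t \<omega>" by (simp add: I_def)
    then show "e\<^sup>2 \<le> (I \<omega>)\<^sup>2" using power_mono[OF \<omega>(1), of 2] e by simp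
  qed
  have "prob {\<omega>\<in>space M. e \<le> \<bar>simple_integral W (k, \<tau>, \<xi>) t \<omega>\<bar> \<and>
      (\<Sum>i<k. (\<xi> i \<omega>)\<^sup>2 * (min t (\<tau> (Suc i)) - min t (\<tau> i))) \<le> \<delta>} \<le> prob {\<omega>\<in>space M. e\<^sup>2 \<le> (I \<omega>)\<^sup>2}"
    using sub IM by (intro finite_measure_mono) auto
  also have "\<dots> \<le> expectation (\<lambda>\<omega>. (I \<omega>)\<^sup>2) / e\<^sup>2"
    using integral_Markov_inequality_measure[OF iso(1), of "{}" "e\<^sup>2"] e by simp
  also have "\<dots> \<le> \<delta> / e\<^sup>2" using exp_le e by (intro divide_right_mono) auto
  finally show ?thesis .
qed

end

section \<open>Locality of the stochastic integral\<close>

text \<open>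
  The set where \<open>P\<close> holds need not be measurable. It lies in the intersection of countably many events
  of arbitrarily small probability.
\<close>

lemma (in prob_space) AE_not_if_covered_by_small_events:
  assumes "\<And>e. 0 < e \<Longrightarrow> \<exists>B\<in>events. {\<omega> \<in> space M. P \<omega>} \<subseteq> B \<and> prob B \<le> e"
  shows "AE \<omega> in M. \<not> P \<omega>"
proof -
  have "\<exists>B. \<forall>n. B n \<in> events \<and> {\<omega> \<in> space M. P \<omega>} \<subseteq> B n \<and> prob (B n) \<le> inverse (Suc n)"
    using assms[of "inverse (real (Suc _))"] by (intro choice) force
  then obtain B where B: "\<And>n. B n \<in> events" "\<And>n. {\<omega> \<in> space M. P \<omega>} \<subseteq> B n"
    "\<And>n. prob (B n) \<le> inverse (Suc n)" by blast
  have "prob (\<Inter>n. B n) \<le> inverse (Suc n)" for n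
    using B by (intro order_trans[OF finite_measure_mono B(3)[of n]]) auto
  then have "prob (\<Inter>n. B n) \<le> 0"
    by (intro LIMSEQ_le_const[OF LIMSEQ_inverse_real_of_nat]) blast
  then have "prob (\<Inter>n. B n) = 0" by (simp add: measure_le_0_iff)
  moreover have "(\<Inter>n. B n) \<in> events" using B by auto
  ultimately have "(\<Inter>n. B n) \<in> null_sets M"
    by (simp add: null_sets_def emeasure_eq_measure)
  then show ?thesis by (rule AE_I') (use B in auto)
qed

lemma vanishes_in_prob_cover:
  assumes "vanishes_in_prob M Z" "0 < e"
  obtains A where "\<And>n. A n \<in> sets M" "\<And>n. {\<omega>\<in>space M. ennreal e < Z n \<omega>} \<subseteq> A n"
    "(\<lambda>n. measure M (A n)) \<longlonglongrightarrow> 0"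
  using assms unfolding vanishes_in_prob_def by metis

context driving_noise
begin

text \<open>
  If \<open>H = 0\<close> on \<open>[0,t]\<close> and \<open>|I\<^sub>t| > e\<close>, then for every approximating simple process \<open>S\<close> one of three things
  happens: \<open>S\<close> is not \<open>\<delta>\<close>-close to \<open>H\<close>, or its integral is not \<open>e/2\<close>-close to \<open>I\<^sub>t\<close>, or its integral is at
  least \<open>e/2\<close> in spite of an energy of at most \<open>\<delta>\<close>. The first two are improbable by approximation, the
  third one by the tail bound if \<open>\<delta>\<close> is small compared with \<open>e\<^sup>2\<close>.
\<close>

lemma ito_integral_eq_0_where_integrand_eq_0:
  assumes ito: "is_ito_integral M F W H I" and t: "0 \<le> t"
  shows "AE \<omega> in M. (\<forall>s\<in>{0..t}. H s \<omega> = 0) \<longrightarrow> I t \<omega> = 0"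
proof -
  obtain S where S: "\<And>n. is_simple_process M F (S n)"
    and S_H: "vanishes_in_prob M
      (\<lambda>n \<omega>. \<integral>\<^sup>+s\<in>{0..t}. ennreal ((simple_value (S n) s \<omega> - H s \<omega>)\<^sup>2) \<partial>lborel)"
    and S_I: "vanishes_in_prob M (\<lambda>n \<omega>. ennreal \<bar>simple_integral W (S n) t \<omega> - I t \<omega>\<bar>)"
    using ito t unfolding is_ito_integral_def by blast
  have large: "AE \<omega> in M. \<not> ((\<forall>s\<in>{0..t}. H s \<omega> = 0) \<and> e < \<bar>I t \<omega>\<bar>)" if e: "0 < e" for e :: real
  proof (rule AE_not_if_covered_by_small_events)
    fix p :: real assume p: "0 < p"
    \<comment> \<open>Chosen so that the tail bound at level \<open>e / 2\<close> is \<open>p / 3\<close>, a third of the allowed probability.\<close>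
    define \<delta> where "\<delta> = p / 3 * (e / 2)\<^sup>2"
    have \<delta>: "0 < \<delta>" using p e by (simp add: \<delta>_def)
    obtain A where A: "\<And>n. A n \<in> events"
      "\<And>n. {\<omega>\<in>space M. ennreal \<delta> < (\<integral>\<^sup>+s\<in>{0..t}. ennreal ((simple_value (S n) s \<omega> - H s \<omega>)\<^sup>2) \<partial>lborel)} \<subseteq> A n"
      "(\<lambda>n. prob (A n)) \<longlonglongrightarrow> 0"
      by (rule vanishes_in_prob_cover[OF S_H \<delta>]) (rule that)
    obtain B where B: "\<And>n. B n \<in> events"
      "\<And>n. {\<omega>\<in>space M. ennreal (e / 2) < ennreal \<bar>simple_integral W (S n) t \<omega> - I t \<omega>\<bar>} \<subseteq> B n"
      "(\<lambda>n. prob (B n)) \<longlonglongrightarrow> 0"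
      by (rule vanishes_in_prob_cover[OF S_I, of "e / 2"]) (use e in simp, rule that)
    have "\<forall>\<^sub>F n in sequentially. prob (A n) < p / 3 \<and> prob (B n) < p / 3"
      using p by (intro eventually_conj order_tendstoD(2)[OF A(3)] order_tendstoD(2)[OF B(3)]) simp_all
    then obtain n where n: "prob (A n) < p / 3" "prob (B n) < p / 3"
      by (auto dest!: eventually_happens)
    obtain k \<tau> \<xi> where Sn: "S n = (k, \<tau>, \<xi>)" by (cases "S n")
    note simple = S[of n, unfolded Sn]
    define G where "G = {\<omega>\<in>space M. e / 2 \<le> \<bar>simple_integral W (k, \<tau>, \<xi>) t \<omega>\<bar> \<and>
      (\<Sum>i<k. (\<xi> i \<omega>)\<^sup>2 * (min t (\<tau> (Suc i)) - min t (\<tau> i))) \<le> \<delta>}"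
    have G: "G \<in> events" unfolding G_def by (rule simple_tail_event[OF simple t])
    have "prob G \<le> \<delta> / (e / 2)\<^sup>2"
      unfolding G_def using simple_integral_tail_bound[OF simple t, of \<delta> "e / 2"] \<delta> e by simp
    also have "\<dots> = p / 3" using e by (simp add: \<delta>_def)
    finally have pG: "prob G \<le> p / 3" .
    have cover: "{\<omega> \<in> space M. (\<forall>s\<in>{0..t}. H s \<omega> = 0) \<and> e < \<bar>I t \<omega>\<bar>} \<subseteq> A n \<union> B n \<union> G"
    proof safe
      fix \<omega> assume \<omega>: "\<omega> \<in> space M" "\<forall>s\<in>{0..t}. H s \<omega> = 0" "e < \<bar>I t \<omega>\<bar>" "\<omega> \<notin> G" "\<omega> \<notin> B n"
      have "(\<integral>\<^sup>+s\<in>{0..t}. ennreal ((simple_value (S n) s \<omega> - H s \<omega>)\<^sup>2) \<partial>lborel) =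
          (\<integral>\<^sup>+s\<in>{0..t}. ennreal ((simple_value (S n) s \<omega>)\<^sup>2) \<partial>lborel)"
        using \<omega>(2) by (intro nn_integral_cong) (auto simp: indicator_def)
      also have "\<dots> = ennreal (\<Sum>i<k. (\<xi> i \<omega>)\<^sup>2 * (min t (\<tau> (Suc i)) - min t (\<tau> i)))"
        unfolding Sn by (rule simple_value_sq_integral[OF simple t])
      finally have energy: "(\<integral>\<^sup>+s\<in>{0..t}. ennreal ((simple_value (S n) s \<omega> - H s \<omega>)\<^sup>2) \<partial>lborel) =
          ennreal (\<Sum>i<k. (\<xi> i \<omega>)\<^sup>2 * (min t (\<tau> (Suc i)) - min t (\<tau> i)))" .
      have "\<not> e / 2 < \<bar>simple_integral W (k, \<tau>, \<xi>) t \<omega> - I t \<omega>\<bar>"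
        using B(2)[of n] \<omega> e by (auto simp: Sn ennreal_less_iff)
      then have "e / 2 \<le> \<bar>simple_integral W (k, \<tau>, \<xi>) t \<omega>\<bar>" using \<omega>(3) by linarith
      then have "\<delta> < (\<Sum>i<k. (\<xi> i \<omega>)\<^sup>2 * (min t (\<tau> (Suc i)) - min t (\<tau> i)))"
        using \<omega>(1,4) by (auto simp: G_def)
      then have "\<omega> \<in> {\<omega>\<in>space M. ennreal \<delta> <
          (\<integral>\<^sup>+s\<in>{0..t}. ennreal ((simple_value (S n) s \<omega> - H s \<omega>)\<^sup>2) \<partial>lborel)}"
        unfolding mem_Collect_eq energy using \<omega>(1) \<delta> by (simp add: ennreal_less_iff)
      then show "\<omega> \<in> A n" using A(2)[of n] by blast
    qed
    have "prob (A n \<union> B n \<union> G) \<le> prob (A n) + prob (B n) + prob G"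
      using measure_Un_le[of "A n \<union> B n" M G] measure_Un_le[of "A n" M "B n"] A B G
      by (simp add: sets.Un)
    also have "\<dots> \<le> p" using n pG by linarith
    finally show "\<exists>E\<in>events. {\<omega> \<in> space M. (\<forall>s\<in>{0..t}. H s \<omega> = 0) \<and> e < \<bar>I t \<omega>\<bar>} \<subseteq> E \<and> prob E \<le> p"
      using cover A(1)[of n] B(1)[of n] G by (intro bexI[of _ "A n \<union> B n \<union> G"]) auto
  qed
  have "AE \<omega> in M. \<forall>n::nat. \<not> ((\<forall>s\<in>{0..t}. H s \<omega> = 0) \<and> inverse (Suc n) < \<bar>I t \<omega>\<bar>)"
    unfolding AE_all_countable using large by simp
  then show ?thesis
  proof (rule eventually_mono, intro impI)
    fix \<omega> assume "\<forall>n::nat. \<not> ((\<forall>s\<in>{0..t}. H s \<omega> = 0) \<and> inverse (Suc n) < \<bar>I t \<omega>\<bar>)"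
      "\<forall>s\<in>{0..t}. H s \<omega> = 0"
    then show "I t \<omega> = 0" using reals_Archimedean[of "\<bar>I t \<omega>\<bar>"] by auto
  qed
qed

end

section \<open>Integrability and positivity along paths\<close>

lemma integral_pos_of_right_continuous:
  fixes y :: "real \<Rightarrow> real"
  assumes int: "set_integrable lborel {0..T} y" and nonneg: "\<And>s. 0 \<le> s \<Longrightarrow> 0 \<le> y s"
    and right: "(y \<longlongrightarrow> y s) (at_right s)" and s: "0 \<le> s" "s < T" and pos: "0 < y s"
  shows "0 < (LBINT s:{0..T}. y s)"
proof -
  have "\<forall>\<^sub>F u in at_right s. y s / 2 < y u"
    using pos by (intro order_tendstoD(1)[OF right]) simp
  then obtain c where c: "s < c" "\<And>u. s < u \<Longrightarrow> u < c \<Longrightarrow> y s / 2 < y u"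
    unfolding eventually_at_right_field by blast
  define r where "r = min c T"
  have r: "s < r" "r \<le> T" "r \<le> c" using c s by (auto simp: r_def)
  have "0 < y s / 2 * (r - s)" using pos r by simp
  also have "\<dots> = (LBINT u:{s<..<r}. y s / 2)"
    using r by (simp add: set_lebesgue_integral_def)
  also have "\<dots> \<le> (LBINT u:{0..T}. y u)"
    unfolding set_lebesgue_integral_def
  proof (rule integral_mono)
    show "integrable lborel (\<lambda>u. indicator {s<..<r} u *\<^sub>R (y s / 2))" using r by simp
    show "integrable lborel (\<lambda>u. indicator {0..T} u *\<^sub>R y u)"
      using int by (simp add: set_integrable_def)
    fix u show "indicator {s<..<r} u *\<^sub>R (y s / 2) \<le> indicator {0..T} u *\<^sub>R y u"
      using c(2)[of u] r s nonneg[of u] by (auto simp: indicator_def less_imp_le)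
  qed
  finally show ?thesis .
qed

text \<open>
  Measurability of the path is recovered as well, since \<open>y\<close> is the square of \<open>\<sigma> \<surd>y\<close> divided by \<open>\<sigma>\<^sup>2\<close>.
\<close>

lemma set_integrable_of_sqrt_square_integrable:
  assumes \<sigma>: "0 < \<sigma>" and nonneg: "\<And>s. 0 \<le> s \<Longrightarrow> 0 \<le> y s"
    and meas: "set_borel_measurable lborel {0..T} (\<lambda>s. \<sigma> * sqrt (y s))"
    and fin: "(\<integral>\<^sup>+s\<in>{0..T}. ennreal ((\<sigma> * sqrt (y s))\<^sup>2) \<partial>lborel) < \<infinity>"
  shows "set_integrable lborel {0..T} y"
proof -
  define g where "g s = indicator {0..T} s *\<^sub>R (\<sigma> * sqrt (y s))" for s
  have "g \<in> borel_measurable lborel"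
    using meas unfolding set_borel_measurable_def g_def .
  moreover have "(\<integral>\<^sup>+s. ennreal (norm ((g s)\<^sup>2)) \<partial>lborel) < \<infinity>"
  proof -
    have "(\<integral>\<^sup>+s. ennreal (norm ((g s)\<^sup>2)) \<partial>lborel) = (\<integral>\<^sup>+s\<in>{0..T}. ennreal ((\<sigma> * sqrt (y s))\<^sup>2) \<partial>lborel)"
      by (intro nn_integral_cong) (auto simp: g_def indicator_def)
    then show ?thesis using fin by simp
  qed
  ultimately have "integrable lborel (\<lambda>s. (g s)\<^sup>2)"
    by (intro integrableI_bounded) auto
  then have "integrable lborel (\<lambda>s. (g s)\<^sup>2 / \<sigma>\<^sup>2)" by simp
  moreover have "(g s)\<^sup>2 / \<sigma>\<^sup>2 = indicator {0..T} s *\<^sub>R y s" for s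
    using \<sigma> nonneg[of s] by (auto simp: g_def indicator_def power_mult_distrib)
  ultimately show ?thesis by (simp add: set_integrable_def)
qed

section \<open>The maximum likelihood estimator\<close>

theorem proposition4p2:
  fixes M :: "'a measure" and m :: "real measure" and W J Y :: "'a process"
    and a b \<sigma> y\<^sub>0 :: real
  assumes "prob_space M"
    and "0 \<le> a" and "0 < \<sigma>" and "0 \<le> y\<^sub>0"
    and "levy_measure_pos m" and "(\<integral>\<^sup>+z\<in>{0<..}. ennreal z \<partial>m) < \<infinity>"
    and "wiener_process M W" and "driftless_subordinator M m J"
    and "independent_processes M W J"
    and "strong_solution M W J a b \<sigma> y\<^sub>0 Y"
    and "0 < a \<or> 0 < y\<^sub>0"
  shows "\<forall>T>0.
    (AE \<omega> in M. \<forall>\<beta>\<^sub>0.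
       (\<exists>!\<beta>. is_mle a \<sigma> y\<^sub>0 T (\<lambda>s. Y s \<omega>) (J T \<omega>) \<beta>\<^sub>0 \<beta>) \<and>
       is_mle a \<sigma> y\<^sub>0 T (\<lambda>s. Y s \<omega>) (J T \<omega>) \<beta>\<^sub>0
         (- ((Y T \<omega> - y\<^sub>0 - a * T - J T \<omega>) / (LBINT s:{0..T}. Y s \<omega>)))) \<and>
    (\<forall>\<omega>\<in>space M.
       set_integrable lborel {0..T} (\<lambda>s. Y s \<omega>) \<and> 0 < (LBINT s:{0..T}. Y s \<omega>) \<longrightarrow>
       (\<forall>\<beta>\<^sub>0.
         (\<exists>!\<beta>. is_mle a \<sigma> y\<^sub>0 T (\<lambda>s. Y s \<omega>) (J T \<omega>) \<beta>\<^sub>0 \<beta>) \<and>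
         is_mle a \<sigma> y\<^sub>0 T (\<lambda>s. Y s \<omega>) (J T \<omega>) \<beta>\<^sub>0
           (- ((Y T \<omega> - y\<^sub>0 - a * T - J T \<omega>) / (LBINT s:{0..T}. Y s \<omega>))))) \<and>
    (AE \<omega> in M.
       set_integrable lborel {0..T} (\<lambda>s. Y s \<omega>) \<and> 0 < (LBINT s:{0..T}. Y s \<omega>))"
proof (intro allI impI)
  fix T :: real assume T: "0 < T"
  note sub = \<open>driftless_subordinator M m J\<close>[unfolded driftless_subordinator_def]
  note sol = \<open>strong_solution M W J a b \<sigma> y\<^sub>0 Y\<close>[unfolded strong_solution_def]
  interpret driving_noise M W J
    using assms(1,7,9) sub by (intro driving_noise.intro driving_noise_axioms.intro) auto
  obtain I where ito: "is_ito_integral M F W (\<lambda>s \<omega>. \<sigma> * sqrt (Y s \<omega>)) I"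
    and eq: "AE \<omega> in M. \<forall>t\<ge>0. Y t \<omega> = y\<^sub>0 + (LBINT s:{0..t}. a - b * Y s \<omega>) + I t \<omega> + J t \<omega>"
    using sol by blast
  \<comment> \<open>Any time strictly between \<open>0\<close> and \<open>T\<close> would do. The time \<open>T\<close> itself would not, because right-continuity leaves \<open>Y\<^sub>T\<close> undetermined by the values on \<open>[0,T)\<close>.\<close>
  have rest: "AE \<omega> in M. (\<forall>s\<in>{0..T/2}. \<sigma> * sqrt (Y s \<omega>) = 0) \<longrightarrow> I (T/2) \<omega> = 0"
    using ito T by (intro ito_integral_eq_0_where_integrand_eq_0) auto
  have "AE \<omega> in M. set_borel_measurable lborel {0..T} (\<lambda>s. \<sigma> * sqrt (Y s \<omega>)) \<and>
      (\<integral>\<^sup>+s\<in>{0..T}. ennreal ((\<sigma> * sqrt (Y s \<omega>))\<^sup>2) \<partial>lborel) < \<infinity>"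
    using ito T unfolding is_ito_integral_def by (auto elim!: eventually_mono)
  moreover have "AE \<omega> in M. cadlag (\<lambda>t. Y t \<omega>)" "AE \<omega> in M. \<forall>t\<ge>0. 0 \<le> Y t \<omega>"
    "AE \<omega> in M. Y 0 \<omega> = y\<^sub>0" using sol by auto
  moreover have "AE \<omega> in M. J 0 \<omega> = 0" "AE \<omega> in M. mono_on {0..} (\<lambda>t. J t \<omega>)"
    using sub by (auto elim!: eventually_mono)
  ultimately have pos: "AE \<omega> in M.
      set_integrable lborel {0..T} (\<lambda>s. Y s \<omega>) \<and> 0 < (LBINT s:{0..T}. Y s \<omega>)"
    using rest eq
  proof eventually_elim
    case (elim \<omega>)
    have int: "set_integrable lborel {0..T} (\<lambda>s. Y s \<omega>)"
      using elim by (intro set_integrable_of_sqrt_square_integrable[OF \<open>0 < \<sigma>\<close>]) auto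
    have zero_or_pos: "0 < (LBINT s:{0..T}. Y s \<omega>)" if "0 \<le> s" "s < T" "0 < Y s \<omega>" for s
      using elim(2,3) that int
      by (intro integral_pos_of_right_continuous[of T "\<lambda>s. Y s \<omega>" s]) (auto simp: cadlag_def)
    have "0 < (LBINT s:{0..T}. Y s \<omega>)"
    proof (rule ccontr)
      assume "\<not> ?thesis"
      then have Y0: "Y s \<omega> = 0" if "0 \<le> s" "s < T" for s
      proof -
        have "\<not> 0 < Y s \<omega>" using zero_or_pos[OF that] \<open>\<not> 0 < _\<close> by blast
        moreover have "0 \<le> Y s \<omega>" using elim(3) that by blast
        ultimately show ?thesis by linarith
      qed
      have "y\<^sub>0 = 0" using Y0[of 0] T elim(4) by simp
      then have "0 < a" using assms(11) by simp
      have "I (T/2) \<omega> = 0" using elim(7) Y0 T by simp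
      moreover have "(LBINT s:{0..T/2}. a - b * Y s \<omega>) = (LBINT s:{0..T/2}. a)"
        using Y0 T by (intro set_lebesgue_integral_cong) auto
      moreover have "\<dots> = a * (T/2)" using T by (simp add: set_lebesgue_integral_def)
      moreover have "0 \<le> J (T/2) \<omega>"
        using mono_onD[OF elim(6), of 0 "T/2"] elim(5) T by simp
      moreover have "Y (T/2) \<omega> = y\<^sub>0 + (LBINT s:{0..T/2}. a - b * Y s \<omega>) + I (T/2) \<omega> + J (T/2) \<omega>"
        using elim(8) T by simp
      moreover have "0 < a * (T/2)" using \<open>0 < a\<close> T by simp
      ultimately show False using Y0[of "T/2"] T \<open>y\<^sub>0 = 0\<close> by simp
    qed
    with int show ?case ..
  qed
  note mle = log_likelihood_unique_maximizer[OF \<open>0 < \<sigma>\<close>]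
  have "AE \<omega> in M. \<forall>\<beta>\<^sub>0.
       (\<exists>!\<beta>. is_mle a \<sigma> y\<^sub>0 T (\<lambda>s. Y s \<omega>) (J T \<omega>) \<beta>\<^sub>0 \<beta>) \<and>
       is_mle a \<sigma> y\<^sub>0 T (\<lambda>s. Y s \<omega>) (J T \<omega>) \<beta>\<^sub>0
         (- ((Y T \<omega> - y\<^sub>0 - a * T - J T \<omega>) / (LBINT s:{0..T}. Y s \<omega>)))"
    using pos by (rule eventually_mono) (intro allI mle, elim conjE)
  with pos show "(AE \<omega> in M. \<forall>\<beta>\<^sub>0.
       (\<exists>!\<beta>. is_mle a \<sigma> y\<^sub>0 T (\<lambda>s. Y s \<omega>) (J T \<omega>) \<beta>\<^sub>0 \<beta>) \<and>
       is_mle a \<sigma> y\<^sub>0 T (\<lambda>s. Y s \<omega>) (J T \<omega>) \<beta>\<^sub>0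
         (- ((Y T \<omega> - y\<^sub>0 - a * T - J T \<omega>) / (LBINT s:{0..T}. Y s \<omega>)))) \<and>
    (\<forall>\<omega>\<in>space M.
       set_integrable lborel {0..T} (\<lambda>s. Y s \<omega>) \<and> 0 < (LBINT s:{0..T}. Y s \<omega>) \<longrightarrow>
       (\<forall>\<beta>\<^sub>0.
         (\<exists>!\<beta>. is_mle a \<sigma> y\<^sub>0 T (\<lambda>s. Y s \<omega>) (J T \<omega>) \<beta>\<^sub>0 \<beta>) \<and>
         is_mle a \<sigma> y\<^sub>0 T (\<lambda>s. Y s \<omega>) (J T \<omega>) \<beta>\<^sub>0
           (- ((Y T \<omega> - y\<^sub>0 - a * T - J T \<omega>) / (LBINT s:{0..T}. Y s \<omega>))))) \<and>
    (AE \<omega> in M.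
       set_integrable lborel {0..T} (\<lambda>s. Y s \<omega>) \<and> 0 < (LBINT s:{0..T}. Y s \<omega>))"
    using mle[of T] by blast
qed

end
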